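(* Let $E=\{1,\dots,m\}$ and let $Z(y_1,\dots,y_m)$ be a multiaffine polynomial with positive coefficients (that is, $Z$ is a nonzero real polynomial and every nonzero coefficient of $Z$ is positive). The following conditions are equivalent: (a) $Z$ is stable; (b) $Z$ has the strong Rayleigh property; (c) for every index $e\in E$, both $Z_e$ and $Z^e$ have the strong Rayleigh property, and for some pair of indices $\{e,f\}\subseteq E$, $\Delta Z\{e,f\}\ge 0$ for all $y_c\in\mathbb{R}$ ($c\in E\smallsetminus\{e,f\}$).
   Context: A polynomial is multiaffine if each variable occurs in it to at most the first power. Stability: $Z$ is stable if $Z(y_1,\dots,y_m)\ne 0$ whenever $y_1,\dots,y_m\in\mathbb{C}$ satisfy $\mathrm{Im}(y_e)>0$ for all $e\in E$. For $e\in E$, $Z_e=\partial Z/\partial y_e$ (contraction) and $Z^e=Z|_{y_e=0}$ (deletion); for multiaffine $Z$, $Z=Z^e+y_eZ_e$, and both $Z_e$ and $Z^e$ are multiaffine polynomials in the variables indexed by $E\smallsetminus\{e\}$. The notation is extended to several distinct sub- and superscripts by applying the operations successively, e.g. $Z_{ef}=\partial^2 Z/\partial y_e\partial y_f$. For distinct $e,f\in E$ the Rayleigh difference is $\Delta Z\{e,f\}=Z_eZ_f-Z_{ef}Z$. For multiaffine $Z$ this equals $Z_e^fZ_f^e-Z_{ef}Z^{ef}$, so it does not depend on $y_e$ or $y_f$. Strong Rayleigh property: a polynomial $Z$ in variables indexed by $E$ has it if, whenever $y_c\in\mathbb{R}$ for all $c\in E$, then $\Delta Z\{e,f\}\ge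 0$ for all pairs $\{e,f\}\subseteq E$ of distinct indices. For $Z_e$ and $Z^e$ the index set is $E\smallsetminus\{e\}$.
   Formalization: The equivalence with (c) is stated only for m ≥ 2, since for m ≤ 1 no pair of distinct indices exists and (c) fails while (a) and (b) hold (e.g. Z = y_1); the equivalence of (a) and (b) is stated for all m. *)

theory Defs
  imports Complex_Main "HOL-Library.Poly_Mapping"
begin

text \<open>
  A real polynomial in variables indexed by a type is a finitely supported map from monomials
  to coefficients, where a monomial is a finitely supported map from variables to exponents.
  The ring structure (convolution product) is the one provided by the library.
\<close>

type_synonym 'v rpoly = "('v \<Rightarrow>\<^sub>0 nat) \<Rightarrow>\<^sub>0 real"

definition vars :: "'v rpoly \<Rightarrow> 'v set" where
  "vars Z = (\<Union>u \<in> Poly_Mapping.keys Z. Poly_Mapping.keys u)"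

definition multiaffine :: "'v rpoly \<Rightarrow> bool" where
  "multiaffine Z \<longleftrightarrow> (\<forall>u \<in> Poly_Mapping.keys Z. \<forall>e. Poly_Mapping.lookup u e \<le> 1)"

definition positive_coeffs :: "'v rpoly \<Rightarrow> bool" where
  "positive_coeffs Z \<longleftrightarrow>
     Z \<noteq> 0 \<and> (\<forall>u. Poly_Mapping.lookup Z u \<noteq> 0 \<longrightarrow> Poly_Mapping.lookup Z u > 0)"

text \<open>
  One evaluation function serves for real and for complex arguments; on the reals
  \<open>of_real\<close> is the identity.
\<close>

definition eval_at :: "('v \<Rightarrow> 'a::real_field) \<Rightarrow> 'v rpoly \<Rightarrow> 'a" where
  "eval_at y Z = (\<Sum>u \<in> Poly_Mapping.keys Z.
     of_real (Poly_Mapping.lookup Z u) *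
       (\<Prod>e \<in> Poly_Mapping.keys u. y e ^ Poly_Mapping.lookup u e))"

text \<open>
  Contraction is the formal partial derivative. When the exponent of \<open>e\<close> in \<open>u\<close> is
  \<open>0\<close> the coefficient of the corresponding summand vanishes, so the truncated
  subtraction of exponents is harmless.
\<close>

definition contraction :: "'v \<Rightarrow> 'v rpoly \<Rightarrow> 'v rpoly" where
  "contraction e Z = (\<Sum>u \<in> Poly_Mapping.keys Z.
     Poly_Mapping.single (u - Poly_Mapping.single e 1)
       (real (Poly_Mapping.lookup u e) * Poly_Mapping.lookup Z u))"

text \<open>Setting the variable \<open>e\<close> to \<open>0\<close> keeps exactly the terms not involving it.\<close>

definition deletion :: "'v \<Rightarrow> 'v rpoly \<Rightarrow> 'v rpoly" where
  "deletion e Z = (\<Sum>u \<in> {u \<in> Poly_Mapping.keys Z. Poly_Mapping.lookup u e = 0}.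
     Poly_Mapping.single u (Poly_Mapping.lookup Z u))"

definition rayleigh_diff :: "'v rpoly \<Rightarrow> 'v \<Rightarrow> 'v \<Rightarrow> 'v rpoly" where
  "rayleigh_diff Z e f =
     contraction e Z * contraction f Z - contraction f (contraction e Z) * Z"

text \<open>
  In the next two definitions \<open>E\<close> is the index set, and \<open>Z\<close> is meant to satisfy
  \<open>vars Z \<subseteq> E\<close>. The points \<open>y\<close> are total functions, but then only their values
  on \<open>E\<close> matter.
\<close>

definition stable_on :: "'v set \<Rightarrow> 'v rpoly \<Rightarrow> bool" where
  "stable_on E Z \<longleftrightarrow>
     (\<forall>y :: 'v \<Rightarrow> complex. (\<forall>e \<in> E. Im (y e) > 0) \<longrightarrow> eval_at y Z \<noteq> 0)"

definition strong_rayleigh :: "'v set \<Rightarrow> 'v rpoly \<Rightarrow> bool" where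
  "strong_rayleigh E Z \<longleftrightarrow>
     (\<forall>y :: 'v \<Rightarrow> real. \<forall>e \<in> E. \<forall>f \<in> E. e \<noteq> f \<longrightarrow> eval_at y (rayleigh_diff Z e f) \<ge> 0)"

end

theory Submission imports Defs begin

text \<open>
  A multiaffine \<open>Z\<close> is affine in each variable, so \<open>\<Delta>Z{e,f}\<close> is, up to sign, the determinant of the
  Moebius transformation that solves \<open>Z = 0\<close> for \<open>y f\<close> in terms of \<open>y e\<close>; a negative value at a
  real point therefore yields a zero in the open upper half-planes, and stability implies the
  strong Rayleigh property.

  Conversely, induct on the number of variables. If \<open>Z\<close> is strongly Rayleigh, then \<open>Z_e\<close> and all
  \<open>Z^e + x Z_e\<close> with \<open>x\<close> real are so too, hence each of them is stable or zero. Unless one of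
  them is zero, \<open>Z^e / Z_e\<close> takes no real value on the product of upper half-planes, so its imaginary
  part has constant sign there. If the sign is positive, \<open>Z\<close> is stable. If it is negative, the Moebius
  argument gives \<open>\<Delta>Z{e,f} \<le> 0\<close>, hence \<open>\<Delta>Z{e,f} = 0\<close> for all \<open>f\<close>, which makes \<open>Z^e / Z_e\<close> a real
  constant, a contradiction.

  For (c) implies (b), the discriminant of \<open>\<Delta>Z{e,f}\<close> in \<open>y g\<close> is symmetric in \<open>e, f, g\<close>, so
  nonnegativity for one pair passes to every pair sharing an index with it.
\<close>

section \<open>Evaluation as a ring homomorphism\<close>

definition monom_eval :: "('v \<Rightarrow> 'a::real_field) \<Rightarrow> ('v \<Rightarrow>\<^sub>0 nat) \<Rightarrow> 'a" where
  "monom_eval y u = (\<Prod>e \<in> Poly_Mapping.keys u. y e ^ Poly_Mapping.lookup u e)"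

lemma monom_eval_superset:
  assumes "finite S" "Poly_Mapping.keys u \<subseteq> S"
  shows "monom_eval y u = (\<Prod>e\<in>S. y e ^ Poly_Mapping.lookup u e)"
  unfolding monom_eval_def using assms
  by (intro prod.mono_neutral_left) (auto simp: in_keys_iff)

lemma monom_eval_0 [simp]: "monom_eval y 0 = 1"
  by (simp add: monom_eval_def)

lemma monom_eval_add: "monom_eval y (u + v) = monom_eval y u * monom_eval y v"
proof -
  let ?S = "Poly_Mapping.keys u \<union> Poly_Mapping.keys v"
  have "Poly_Mapping.keys (u + v) \<subseteq> ?S"
    by (rule keys_add)
  then show ?thesis
    by (simp add: monom_eval_superset[of ?S] lookup_add power_add prod.distrib)
qed

lemma eval_at_superset:
  assumes "finite S" "Poly_Mapping.keys P \<subseteq> S"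
  shows "eval_at y P = (\<Sum>u\<in>S. of_real (Poly_Mapping.lookup P u) * monom_eval y u)"
  unfolding eval_at_def monom_eval_def using assms
  by (intro sum.mono_neutral_left) (auto simp: in_keys_iff)

lemma eval_at_0 [simp]: "eval_at y 0 = 0"
  by (simp add: eval_at_def)

lemma eval_at_single: "eval_at y (Poly_Mapping.single u c) = of_real c * monom_eval y u"
  by (subst eval_at_superset[of "{u}"]) auto

lemma eval_at_add: "eval_at y (P + Q) = eval_at y P + eval_at y Q"
proof -
  let ?S = "Poly_Mapping.keys P \<union> Poly_Mapping.keys Q"
  have "Poly_Mapping.keys (P + Q) \<subseteq> ?S"
    by (rule keys_add)
  then show ?thesis
    by (simp add: eval_at_superset[of ?S] lookup_add sum.distrib algebra_simps)
qed

lemma eval_at_diff: "eval_at y (P - Q) = eval_at y P - eval_at y Q"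
  using eval_at_add[of y "P - Q" Q] by (simp add: algebra_simps)

lemma eval_at_sum: "eval_at y (sum f A) = (\<Sum>i\<in>A. eval_at y (f i))"
  by (induction A rule: infinite_finite_induct) (auto simp: eval_at_add)

lemma poly_mapping_sum_single:
  "P = (\<Sum>u\<in>Poly_Mapping.keys P. Poly_Mapping.single u (Poly_Mapping.lookup P u))"
proof (rule poly_mapping_eqI)
  fix k
  show "Poly_Mapping.lookup P k =
    Poly_Mapping.lookup (\<Sum>u\<in>Poly_Mapping.keys P. Poly_Mapping.single u (Poly_Mapping.lookup P u)) k"
    by (auto simp: lookup_sum lookup_single when_def in_keys_iff)
qed

lemma eval_at_mult: "eval_at y (P * Q) = eval_at y P * eval_at y Q"
proof -
  have "P * Q = (\<Sum>u\<in>Poly_Mapping.keys P. \<Sum>v\<in>Poly_Mapping.keys Q.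
      Poly_Mapping.single (u + v) (Poly_Mapping.lookup P u * Poly_Mapping.lookup Q v))"
    by (subst poly_mapping_sum_single[of P], subst poly_mapping_sum_single[of Q])
      (simp add: sum_product mult_single)
  then have "eval_at y (P * Q) = (\<Sum>u\<in>Poly_Mapping.keys P. \<Sum>v\<in>Poly_Mapping.keys Q.
      (of_real (Poly_Mapping.lookup P u) * monom_eval y u) *
      (of_real (Poly_Mapping.lookup Q v) * monom_eval y v))"
    by (simp add: eval_at_sum eval_at_single monom_eval_add mult_ac)
  also have "\<dots> = eval_at y P * eval_at y Q"
    by (simp add: sum_product eval_at_superset[of "Poly_Mapping.keys P"]
        eval_at_superset[of "Poly_Mapping.keys Q"])
  finally show ?thesis .
qed

lemma eval_at_of_real: "eval_at (\<lambda>v. of_real (y v)) P = of_real (eval_at y P)"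
  by (simp add: eval_at_def)

lemma eval_at_cong:
  assumes "\<And>v. v \<in> vars P \<Longrightarrow> y v = z v"
  shows "eval_at y P = eval_at z P"
proof -
  have "y v = z v" if "u \<in> Poly_Mapping.keys P" "v \<in> Poly_Mapping.keys u" for u v
    using assms that by (auto simp: vars_def)
  then show ?thesis
    by (simp add: eval_at_def)
qed

lemma continuous_eval_at:
  fixes y :: "'b::t2_space \<Rightarrow> 'v \<Rightarrow> 'a::real_normed_field"
  assumes "\<And>v. continuous F (\<lambda>t. y t v)"
  shows "continuous F (\<lambda>t. eval_at (y t) P)"
  unfolding eval_at_def using assms by (intro continuous_intros)

section \<open>Affine dependence on each variable; deletion and contraction\<close>

text \<open>With exponent 0 or 1 at \<open>e\<close>, a monomial is affine in \<open>y e\<close>, so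
  its values at 0 and 1 determine it. Deletion, contraction and evaluation are all reduced to these
  two values.\<close>

lemma monom_eval_split:
  fixes y :: "'v \<Rightarrow> 'a::real_field"
  assumes "Poly_Mapping.lookup u e \<le> 1"
  shows "monom_eval (y(e := 0)) u = (if Poly_Mapping.lookup u e = 0 then monom_eval y u else 0)"
    and "real (Poly_Mapping.lookup u e) *\<^sub>R monom_eval y (u - Poly_Mapping.single e 1) =
         monom_eval (y(e := 1)) u - monom_eval (y(e := 0)) u"
    and "monom_eval y u = (1 - y e) * monom_eval (y(e := 0)) u + y e * monom_eval (y(e := 1)) u"
proof -
  let ?S = "insert e (Poly_Mapping.keys u)"
  \<comment> \<open>The cofactor of the power of \<open>y e\<close>; changing \<open>y e\<close>
    leaves it alone.\<close>
  let ?p = "\<Prod>v\<in>Poly_Mapping.keys u - {e}. y v ^ Poly_Mapping.lookup u v"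
  have split: "monom_eval z u = z e ^ Poly_Mapping.lookup u e *
      (\<Prod>v\<in>Poly_Mapping.keys u - {e}. z v ^ Poly_Mapping.lookup u v)" for z :: "'v \<Rightarrow> 'a"
    by (subst monom_eval_superset[of ?S]) (auto simp: prod.insert_remove)
  have upd: "monom_eval (y(e := t)) u = t ^ Poly_Mapping.lookup u e * ?p" for t
    unfolding split by (intro arg_cong2[where f = "(*)"] prod.cong) auto
  have y: "monom_eval y u = y e ^ Poly_Mapping.lookup u e * ?p"
    using upd[of "y e"] by simp
  show "monom_eval (y(e := 0)) u = (if Poly_Mapping.lookup u e = 0 then monom_eval y u else 0)"
    by (simp add: upd y)
  have cases: "Poly_Mapping.lookup u e = 0 \<or> Poly_Mapping.lookup u e = 1"
    using assms by linarith
  then show "monom_eval y u = (1 - y e) * monom_eval (y(e := 0)) u + y e * monom_eval (y(e := 1)) u"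
    unfolding upd y by (auto simp: algebra_simps)
  have "Poly_Mapping.keys (u - Poly_Mapping.single e 1) = Poly_Mapping.keys u - {e}"
    if "Poly_Mapping.lookup u e = 1"
    using that by (auto simp: in_keys_iff lookup_minus lookup_single when_def split: if_splits)
  then have "monom_eval y (u - Poly_Mapping.single e 1) = ?p" if "Poly_Mapping.lookup u e = 1"
    unfolding monom_eval_def using that
    by (intro prod.cong) (auto simp: lookup_minus lookup_single when_def)
  then show "real (Poly_Mapping.lookup u e) *\<^sub>R monom_eval y (u - Poly_Mapping.single e 1) =
         monom_eval (y(e := 1)) u - monom_eval (y(e := 0)) u"
    using cases by (auto simp: upd)
qed

lemma eval_at_deletion:
  assumes "multiaffine P"
  shows "eval_at y (deletion e P) = eval_at (y(e := 0)) P"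
proof -
  have "eval_at (y(e := 0)) P = (\<Sum>u\<in>Poly_Mapping.keys P. if Poly_Mapping.lookup u e = 0
      then of_real (Poly_Mapping.lookup P u) * monom_eval y u else 0)"
    unfolding eval_at_superset[OF finite_keys order_refl]
    using assms by (intro sum.cong) (auto simp: multiaffine_def monom_eval_split(1))
  then show ?thesis
    by (simp add: deletion_def eval_at_sum eval_at_single flip: sum.inter_filter)
qed

text \<open>The slope of an affine function is its increment from 0 to 1.\<close>

lemma eval_at_contraction:
  assumes "multiaffine P"
  shows "eval_at y (contraction e P) = eval_at (y(e := 1)) P - eval_at (y(e := 0)) P"
proof -
  have "eval_at y (contraction e P) = (\<Sum>u\<in>Poly_Mapping.keys P. of_real (Poly_Mapping.lookup P u) *
      (real (Poly_Mapping.lookup u e) *\<^sub>R monom_eval y (u - Poly_Mapping.single e 1)))"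
    by (simp add: contraction_def eval_at_sum eval_at_single scaleR_conv_of_real mult_ac)
  also have "\<dots> = (\<Sum>u\<in>Poly_Mapping.keys P. of_real (Poly_Mapping.lookup P u) *
      (monom_eval (y(e := 1)) u - monom_eval (y(e := 0)) u))"
    using assms by (intro sum.cong arg_cong2[where f = "(*)"] monom_eval_split(2))
      (auto simp: multiaffine_def)
  finally show ?thesis
    by (simp add: eval_at_superset[of "Poly_Mapping.keys P"] right_diff_distrib sum_subtractf)
qed

lemma eval_at_affine:
  assumes "multiaffine P"
  shows "eval_at y P = (1 - y e) * eval_at (y(e := 0)) P + y e * eval_at (y(e := 1)) P"
proof -
  have "eval_at y P = (\<Sum>u\<in>Poly_Mapping.keys P. of_real (Poly_Mapping.lookup P u) *
      ((1 - y e) * monom_eval (y(e := 0)) u + y e * monom_eval (y(e := 1)) u))"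
    unfolding eval_at_superset[OF finite_keys order_refl] using assms
    by (intro sum.cong arg_cong2[where f = "(*)"] monom_eval_split(3)) (auto simp: multiaffine_def)
  then show ?thesis
    by (simp add: eval_at_superset[of "Poly_Mapping.keys P"] distrib_left sum.distrib
        sum_distrib_left mult_ac)
qed

lemma eval_at_upd_affine:
  assumes "multiaffine P"
  shows "eval_at (y(e := t)) P = (1 - t) * eval_at (y(e := 0)) P + t * eval_at (y(e := 1)) P"
  using eval_at_affine[OF assms, of "y(e := t)" e] by simp

lemma keys_contraction:
  "Poly_Mapping.keys (contraction e P) \<subseteq>
     (\<lambda>u. u - Poly_Mapping.single e 1) ` Poly_Mapping.keys P"
  unfolding contraction_def
  by (rule order_trans[OF keys_sum]) (auto split: if_splits)

lemma keys_deletion: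
  "Poly_Mapping.keys (deletion e P) \<subseteq> {u \<in> Poly_Mapping.keys P. Poly_Mapping.lookup u e = 0}"
  unfolding deletion_def
  by (rule order_trans[OF keys_sum]) (auto split: if_splits)

lemma multiaffine_contraction: "multiaffine P \<Longrightarrow> multiaffine (contraction e P)"
  unfolding multiaffine_def
  by (auto dest!: subsetD[OF keys_contraction] simp: lookup_minus intro!: le_trans[OF diff_le_self])

lemma multiaffine_deletion: "multiaffine P \<Longrightarrow> multiaffine (deletion e P)"
  using keys_deletion[of e P] by (auto simp: multiaffine_def)

lemma vars_contraction:
  assumes "multiaffine P"
  shows "vars (contraction e P) \<subseteq> vars P - {e}"
proof
  fix v assume "v \<in> vars (contraction e P)"
  then obtain u where u: "u \<in> Poly_Mapping.keys P"
      and v: "v \<in> Poly_Mapping.keys (u - Poly_Mapping.single e 1)"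
    using keys_contraction[of e P] by (auto simp: vars_def)
  moreover have "Poly_Mapping.lookup u e \<le> 1"
    using assms u by (auto simp: multiaffine_def)
  ultimately show "v \<in> vars P - {e}"
    by (auto simp: vars_def in_keys_iff lookup_minus lookup_single when_def split: if_splits)
qed

lemma vars_deletion: "vars (deletion e P) \<subseteq> vars P - {e}"
proof
  fix v assume "v \<in> vars (deletion e P)"
  then obtain u where u: "u \<in> Poly_Mapping.keys P" "Poly_Mapping.lookup u e = 0"
      "v \<in> Poly_Mapping.keys u"
    using keys_deletion[of e P] by (auto simp: vars_def)
  then have "v \<noteq> e"
    by (auto simp: in_keys_iff)
  with u show "v \<in> vars P - {e}"
    by (auto simp: vars_def)
qed

lemma multiaffine_add: "multiaffine P \<Longrightarrow> multiaffine Q \<Longrightarrow> multiaffine (P + Q)"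
  using keys_add[of P Q] by (auto simp: multiaffine_def)

lemma vars_add: "vars (P + Q) \<subseteq> vars P \<union> vars Q"
  using keys_add[of P Q] by (auto simp: vars_def)

lemma keys_const_mult: "Poly_Mapping.keys (Poly_Mapping.single 0 c * P) \<subseteq> Poly_Mapping.keys P"
  for P :: "'v rpoly"
  using keys_mult[of "Poly_Mapping.single 0 c" P] by (auto split: if_splits)

section \<open>Real specializations and Rayleigh differences as determinants\<close>

text \<open>For multiaffine \<open>P\<close> this substitutes the real number \<open>x\<close> for
  \<open>e\<close>. The result is again a multiaffine polynomial, now without \<open>e\<close>, so
  induction on the variables applies to it.\<close>

definition restrict_var :: "'v \<Rightarrow> real \<Rightarrow> 'v rpoly \<Rightarrow> 'v rpoly" where
  "restrict_var e x P = deletion e P + Poly_Mapping.single 0 x * contraction e P"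

lemma eval_at_restrict_var:
  assumes "multiaffine P"
  shows "eval_at y (restrict_var e x P) = eval_at (y(e := of_real x)) P"
  using eval_at_upd_affine[OF assms, of y e "of_real x"]
  by (simp add: restrict_var_def eval_at_add eval_at_mult eval_at_single
      eval_at_deletion[OF assms] eval_at_contraction[OF assms] algebra_simps)

lemma multiaffine_restrict_var:
  assumes "multiaffine P"
  shows "multiaffine (restrict_var e x P)"
proof -
  have "multiaffine (Poly_Mapping.single 0 x * contraction e P)"
    using multiaffine_contraction[OF assms, of e] keys_const_mult[of x "contraction e P"]
    by (auto simp: multiaffine_def)
  then show ?thesis
    unfolding restrict_var_def by (intro multiaffine_add multiaffine_deletion assms)
qed

lemma vars_restrict_var:
  assumes "multiaffine P"
  shows "vars (restrict_var e x P) \<subseteq> vars P - {e}"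
proof -
  have "vars (Poly_Mapping.single 0 x * contraction e P) \<subseteq> vars (contraction e P)"
    using keys_const_mult[of x "contraction e P"] by (auto simp: vars_def)
  then show ?thesis
    unfolding restrict_var_def
    using vars_add[of "deletion e P" "Poly_Mapping.single 0 x * contraction e P"]
      vars_deletion[of e P] vars_contraction[OF assms, of e] by auto
qed

text \<open>As a polynomial in \<open>y e\<close> and \<open>y f\<close>, \<open>P\<close> has a 2
  by 2 coefficient matrix, and the Rayleigh difference is minus its determinant. Passing from
  coefficients to values at 0 and 1 is unimodular, so the array of corner values has the same
  determinant.\<close>

lemma eval_at_rayleigh_diff:
  assumes P: "multiaffine P" and "e \<noteq> f"
  shows "eval_at y (rayleigh_diff P e f) =
    eval_at (y(e := 1, f := 0)) P * eval_at (y(e := 0, f := 1)) P -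
    eval_at (y(e := 1, f := 1)) P * eval_at (y(e := 0, f := 0)) P"
proof -
  define p where "p i j = eval_at (y(e := i, f := j)) P" for i j
  have swap: "eval_at (y(f := j, e := i)) P = p i j" for i j
    using \<open>e \<noteq> f\<close> by (simp add: p_def fun_upd_twist)
  have e: "eval_at (y(e := i)) P = (1 - y f) * p i 0 + y f * p i 1" for i
    using eval_at_affine[OF P, of "y(e := i)" f] \<open>e \<noteq> f\<close> by (simp add: p_def)
  have f: "eval_at (y(f := j)) P = (1 - y e) * p 0 j + y e * p 1 j" for j
    using eval_at_affine[OF P, of "y(f := j)" e] \<open>e \<noteq> f\<close> by (simp add: swap)
  have y: "eval_at y P = (1 - y e) * eval_at (y(e := 0)) P + y e * eval_at (y(e := 1)) P"
    by (rule eval_at_affine[OF P])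
  have ef: "eval_at y (contraction f (contraction e P)) = p 1 1 - p 0 1 - (p 1 0 - p 0 0)"
    by (simp add: eval_at_contraction multiaffine_contraction P swap)
  have "eval_at y (rayleigh_diff P e f) = p 1 0 * p 0 1 - p 1 1 * p 0 0"
    unfolding rayleigh_diff_def eval_at_diff eval_at_mult ef eval_at_contraction[OF P] y e f
    by (simp add: algebra_simps)
  then show ?thesis by (simp add: p_def)
qed

lemma eval_at_upd2_affine:
  assumes "multiaffine P" "e \<noteq> f"
  shows "eval_at (y(e := s, f := t)) P =
    (1 - s) * ((1 - t) * eval_at (y(e := 0, f := 0)) P + t * eval_at (y(e := 0, f := 1)) P) +
    s * ((1 - t) * eval_at (y(e := 1, f := 0)) P + t * eval_at (y(e := 1, f := 1)) P)"
proof -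
  have "y(f := t, e := i) = y(e := i, f := t)" for i
    using assms(2) by (rule fun_upd_twist[OF not_sym])
  then have "eval_at (y(e := s, f := t)) P = (1 - s) * eval_at (y(e := 0, f := t)) P +
      s * eval_at (y(e := 1, f := t)) P"
    using eval_at_upd_affine[OF assms(1), of "y(f := t)" e s] by metis
  then show ?thesis
    using eval_at_upd_affine[OF assms(1), of "y(e := 0)" f t]
      eval_at_upd_affine[OF assms(1), of "y(e := 1)" f t] by metis
qed

section \<open>Stability implies the strong Rayleigh property\<close>

text \<open>
  The zero is found at \<open>y e = \<i> s\<close> with the other variables real, and it persists when these are
  shifted slightly into the upper half-plane.
\<close>

lemma zero_of_rayleigh_diff:
  fixes P :: "'v rpoly" and x :: "'v \<Rightarrow> real"
  assumes P: "multiaffine P" and ef: "e \<noteq> f"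
    and neg: "s * eval_at x (rayleigh_diff P e f) < 0"
  obtains y :: "'v \<Rightarrow> complex"
  where "y e = Complex 0 s" "\<And>c. c \<noteq> e \<Longrightarrow> Im (y c) > 0" "eval_at y P = 0"
proof -
  define Y :: "real \<Rightarrow> 'v \<Rightarrow> complex" where "Y \<epsilon> = (\<lambda>c. Complex (x c) \<epsilon>)" for \<epsilon>
  define p where "p \<epsilon> i j = eval_at ((Y \<epsilon>)(e := i, f := j)) P" for \<epsilon> i j
  define r where "r i j = eval_at (x(e := i, f := j)) P" for i j
  \<comment> \<open>With \<open>u\<close> in place of \<open>y e\<close>, the polynomial is
    \<open>N + D * y f\<close>; hence \<open>v\<close> is its root in \<open>y f\<close>.\<close>
  define u where "u = Complex 0 s"
  define N where "N \<epsilon> = (1 - u) * p \<epsilon> 0 0 + u * p \<epsilon> 1 0" for \<epsilon>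
  define D where "D \<epsilon> = (1 - u) * (p \<epsilon> 0 1 - p \<epsilon> 0 0) + u * (p \<epsilon> 1 1 - p \<epsilon> 1 0)" for \<epsilon>
  define v where "v \<epsilon> = - (N \<epsilon> / D \<epsilon>)" for \<epsilon>
  have cont_p: "isCont (\<lambda>\<epsilon>. p \<epsilon> i j) 0" for i j
  proof -
    have "isCont (\<lambda>\<epsilon>. ((Y \<epsilon>)(e := i, f := j)) v) 0" for v
      by (cases "v = f"; cases "v = e") (auto simp: Y_def Complex_eq)
    then show ?thesis
      unfolding p_def by (rule continuous_eval_at)
  qed
  have "(Y 0)(e := of_real i, f := of_real j) = (\<lambda>v. of_real ((x(e := i, f := j)) v))"
    for i j :: real
    by (auto simp: Y_def complex_of_real_def)
  then have p0: "p 0 (of_real i) (of_real j) = of_real (r i j)" for i j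
    unfolding p_def r_def by (metis eval_at_of_real)
  have p0': "p 0 0 0 = of_real (r 0 0)" "p 0 0 1 = of_real (r 0 1)"
      "p 0 1 0 = of_real (r 1 0)" "p 0 1 1 = of_real (r 1 1)"
    using p0[of 0 0] p0[of 0 1] p0[of 1 0] p0[of 1 1] by auto
  have neg': "s * (r 1 0 * r 0 1 - r 1 1 * r 0 0) < 0"
    using neg by (simp add: eval_at_rayleigh_diff[OF P ef] r_def)
  \<comment> \<open>At \<epsilon> = 0 the polynomial is
    \<open>a + b * y e + c * y f + d * y e * y f\<close>, with Rayleigh difference
    \<open>b * c - a * d\<close>.\<close>
  define a b c d where "a = r 0 0" and "b = r 1 0 - r 0 0" and "c = r 0 1 - r 0 0"
    and "d = r 1 1 - r 1 0 - r 0 1 + r 0 0"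
  have neg'': "s * (b * c - a * d) < 0"
    using neg' by (simp add: a_def b_def c_def d_def algebra_simps)
  have N0: "N 0 = Complex a (b * s)" and D0: "D 0 = Complex c (d * s)"
    by (simp_all add: N_def D_def u_def p0' a_def b_def c_def d_def complex_eq_iff algebra_simps)
  \<comment> \<open>If \<open>c\<close> and \<open>d * s\<close> both vanished, so would
    \<open>s * (b * c - a * d)\<close>.\<close>
  have D0_nz: "D 0 \<noteq> 0"
    using neg'' by (auto simp: D0 complex_eq_iff)
  then have pos: "c\<^sup>2 + (d * s)\<^sup>2 > 0"
    by (simp add: D0 complex_eq_iff sum_power2_gt_zero_iff)
  have "Im (v 0) = - (s * (b * c - a * d) / (c\<^sup>2 + (d * s)\<^sup>2))"
    by (simp add: v_def N0 D0 Im_divide algebra_simps)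
  also have "\<dots> > 0"
    using neg'' pos by (simp add: divide_neg_pos)
  finally have v0: "Im (v 0) > 0" .
  have cont_D: "isCont D 0" and cont_N: "isCont N 0"
    unfolding D_def N_def by (intro continuous_intros cont_p)+
  have cont_v: "isCont (\<lambda>\<epsilon>. Im (v \<epsilon>)) 0"
    unfolding v_def by (intro isCont_Im continuous_intros cont_D cont_N D0_nz)
  have "(D \<longlongrightarrow> D 0) (at_right 0)" "((\<lambda>\<epsilon>. Im (v \<epsilon>)) \<longlongrightarrow> Im (v 0)) (at_right 0)"
    using cont_D cont_v by (auto simp: isCont_def intro: tendsto_within_subset)
  then have "eventually (\<lambda>\<epsilon>. D \<epsilon> \<noteq> 0) (at_right 0)" "eventually (\<lambda>\<epsilon>. Im (v \<epsilon>) > 0) (at_right 0)"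
    using D0_nz v0 by (auto intro: tendsto_imp_eventually_ne order_tendstoD)
  then have "eventually (\<lambda>\<epsilon>. D \<epsilon> \<noteq> 0 \<and> Im (v \<epsilon>) > 0 \<and> \<epsilon> > 0) (at_right 0)"
    using eventually_at_right_less[of 0] by eventually_elim auto
  then obtain \<epsilon> where \<epsilon>: "D \<epsilon> \<noteq> 0" "Im (v \<epsilon>) > 0" "\<epsilon> > 0"
    using eventually_happens trivial_limit_at_right_real by blast
  have "eval_at ((Y \<epsilon>)(e := u, f := v \<epsilon>)) P = N \<epsilon> + v \<epsilon> * D \<epsilon>"
    using eval_at_upd2_affine[OF P ef, of "Y \<epsilon>" u "v \<epsilon>"]
    by (simp add: p_def N_def D_def algebra_simps)
  also have "\<dots> = 0"
    using \<epsilon>(1) by (simp add: v_def)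
  finally show thesis
    using \<epsilon>(2,3) ef by (intro that[of "(Y \<epsilon>)(e := u, f := v \<epsilon>)"]) (auto simp: u_def Y_def)
qed

lemma stable_imp_strong_rayleigh:
  assumes P: "multiaffine P" and "stable_on E P"
  shows "strong_rayleigh E P"
  unfolding strong_rayleigh_def
proof (intro allI ballI impI, rule ccontr)
  fix y :: "'a \<Rightarrow> real" and e f assume "e \<in> E" "f \<in> E" "e \<noteq> f" "\<not> 0 \<le> eval_at y (rayleigh_diff P e f)"
  \<comment> \<open>The choice \<open>s = 1\<close> puts \<open>y e\<close> in the upper half-plane
    as well.\<close>
  then have "1 * eval_at y (rayleigh_diff P e f) < 0"
    by simp
  from zero_of_rayleigh_diff[OF P \<open>e \<noteq> f\<close> this]
  obtain z where z: "z e = Complex 0 1" "\<And>c. c \<noteq> e \<Longrightarrow> Im (z c) > 0" "eval_at z P = 0"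
    by metis
  have "Im (z c) > 0" for c
    using z(1,2) by (cases "c = e") auto
  with z(3) \<open>stable_on E P\<close> show False
    by (auto simp: stable_on_def)
qed

section \<open>Exchanging an index of a nonnegative Rayleigh difference\<close>

text \<open>The Rayleigh difference is a quadratic form in the corner values, each of which is
  affine in \<open>y g\<close>. The constant and leading coefficients of the resulting quadratic are
  the Rayleigh differences of the two minors at \<open>g\<close>.\<close>

lemma rayleigh_diff_quadratic:
  fixes y :: "'v \<Rightarrow> real"
  assumes P: "multiaffine P" and d: "e \<noteq> f" "e \<noteq> g" "f \<noteq> g"
  defines "p \<equiv> \<lambda>i j k. eval_at (y(e := i, f := j, g := k)) P"
  shows "eval_at y (rayleigh_diff (deletion g P) e f) = p 1 0 0 * p 0 1 0 - p 1 1 0 * p 0 0 0"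
    and "eval_at y (rayleigh_diff (contraction g P) e f) =
      (p 1 0 1 - p 1 0 0) * (p 0 1 1 - p 0 1 0) - (p 1 1 1 - p 1 1 0) * (p 0 0 1 - p 0 0 0)"
    and "eval_at (y(g := t)) (rayleigh_diff P e f) =
      eval_at y (rayleigh_diff (deletion g P) e f) +
      (p 1 0 0 * (p 0 1 1 - p 0 1 0) + p 0 1 0 * (p 1 0 1 - p 1 0 0)
       - p 1 1 0 * (p 0 0 1 - p 0 0 0) - p 0 0 0 * (p 1 1 1 - p 1 1 0)) * t +
      eval_at y (rayleigh_diff (contraction g P) e f) * t\<^sup>2"
proof -
  show C: "eval_at y (rayleigh_diff (deletion g P) e f) =
      p 1 0 0 * p 0 1 0 - p 1 1 0 * p 0 0 0"
    by (simp add: eval_at_rayleigh_diff multiaffine_deletion eval_at_deletion P d p_def)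
  show A: "eval_at y (rayleigh_diff (contraction g P) e f) =
      (p 1 0 1 - p 1 0 0) * (p 0 1 1 - p 0 1 0) - (p 1 1 1 - p 1 1 0) * (p 0 0 1 - p 0 0 0)"
    by (simp add: eval_at_rayleigh_diff multiaffine_contraction eval_at_contraction P d p_def)
  have "eval_at (y(g := t, e := i, f := j)) P = (1 - t) * p i j 0 + t * p i j 1" for i j
  proof -
    have "y(g := t, e := i, f := j) = y(e := i, f := j, g := t)"
      using d by auto
    then show ?thesis
      using eval_at_upd_affine[OF P, of "y(e := i, f := j)" g t] by (simp add: p_def)
  qed
  note expand = this
  show "eval_at (y(g := t)) (rayleigh_diff P e f) =
      eval_at y (rayleigh_diff (deletion g P) e f) +
      (p 1 0 0 * (p 0 1 1 - p 0 1 0) + p 0 1 0 * (p 1 0 1 - p 1 0 0)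
       - p 1 1 0 * (p 0 0 1 - p 0 0 0) - p 0 0 0 * (p 1 1 1 - p 1 1 0)) * t +
      eval_at y (rayleigh_diff (contraction g P) e f) * t\<^sup>2"
    unfolding A C eval_at_rayleigh_diff[OF P d(1)] expand
    by (simp add: algebra_simps power2_eq_square)
qed

lemma quadratic_nonneg_leading:
  fixes a b c :: real
  assumes "\<And>t. c + b * t + a * t\<^sup>2 \<ge> 0"
  shows "a \<ge> 0"
proof (rule ccontr)
  assume "\<not> a \<ge> 0"
  then have a: "a < 0" by simp
  have c: "c \<ge> 0" using assms[of 0] by simp
  \<comment> \<open>Chosen so that \<open>t \<ge> 1\<close> and \<open>a * t = a - c\<close>. Adding
    the values at \<open>t\<close> and \<open>- t\<close> cancels \<open>b\<close> and leaves at
    most \<open>2 * a\<close>, which is negative.\<close>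
  define t where "t = 1 + c / (- a)"
  have "t \<ge> 1"
    using a c by (simp add: t_def divide_nonneg_neg)
  then have "t \<le> t\<^sup>2"
    by (simp add: power2_eq_square)
  then have "a * t\<^sup>2 \<le> a * t"
    using a by simp
  also have "a * t = a - c"
    using a by (simp add: t_def field_simps)
  finally show False
    using assms[of t] assms[of "- t"] a by simp
qed

lemma quadratic_nonneg_imp_discriminant:
  fixes a b c :: real
  assumes "\<And>t. c + b * t + a * t\<^sup>2 \<ge> 0"
  shows "b\<^sup>2 \<le> 4 * a * c"
proof (cases "a = 0")
  case True
  have "b = 0"
  proof (rule ccontr)
    assume "b \<noteq> 0"
    then show False
      using assms[of "- (c + 1) / b"] True by simp
  qed
  with True show ?thesis by simp
next
  case False
  with quadratic_nonneg_leading[OF assms] have a: "a > 0" by simp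
  have "c + b * (- b / (2 * a)) + a * (- b / (2 * a))\<^sup>2 = c - b\<^sup>2 / (4 * a)"
    using a by (simp add: field_simps power2_eq_square)
  with assms[of "- b / (2 * a)"] have "b\<^sup>2 / (4 * a) \<le> c"
    by simp
  with a show ?thesis
    by (simp add: field_simps)
qed

lemma quadratic_nonneg_if_discriminant:
  fixes a b c :: real
  assumes "a \<ge> 0" "c \<ge> 0" "b\<^sup>2 \<le> 4 * a * c"
  shows "c + b * t + a * t\<^sup>2 \<ge> 0"
proof (cases "a = 0")
  case True
  with assms show ?thesis by simp
next
  case False
  then have a: "a > 0" using assms(1) by simp
  have "4 * a * (c + b * t + a * t\<^sup>2) = (2 * a * t + b)\<^sup>2 + (4 * a * c - b\<^sup>2)"
    by (simp add: algebra_simps power2_eq_square)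
  also have "\<dots> \<ge> 0"
    using assms(3) by simp
  finally show ?thesis
    using a by (simp add: zero_le_mult_iff)
qed

text \<open>
  Both sides are the discriminant of a Rayleigh difference as a quadratic in a third variable,
  that is, Cayley's hyperdeterminant of the \<open>2 \<times> 2 \<times> 2\<close> array of values of \<open>P\<close>.
\<close>

lemma hyperdeterminant_symmetric:
  fixes a :: real
  shows "(a * (b - c) + c * (d - a) - e * (f - g) - g * (h - e))\<^sup>2 -
      4 * ((d - a) * (b - c) - (h - e) * (f - g)) * (a * c - e * g) =
    (a * (b - f) + f * (e - a) - d * (c - g) - g * (h - d))\<^sup>2 -
      4 * ((e - a) * (b - f) - (h - d) * (c - g)) * (a * f - d * g)"
  by algebra

text \<open>Nonnegativity for \<open>e, f\<close> along \<open>y g\<close> makes a discriminant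
  nonpositive. By symmetry it is also the discriminant for \<open>e, g\<close> along
  \<open>y f\<close>, whose outer coefficients are nonnegative by the assumptions on the minors at
  \<open>f\<close>.\<close>

lemma rayleigh_diff_nonneg_exchange:
  fixes P :: "'v rpoly"
  assumes P: "multiaffine P" and d: "e \<noteq> f" "e \<noteq> g" "f \<noteq> g"
    and ef: "\<And>y :: 'v \<Rightarrow> real. eval_at y (rayleigh_diff P e f) \<ge> 0"
    and del: "\<And>y :: 'v \<Rightarrow> real. eval_at y (rayleigh_diff (deletion f P) e g) \<ge> 0"
    and con: "\<And>y :: 'v \<Rightarrow> real. eval_at y (rayleigh_diff (contraction f P) e g) \<ge> 0"
  shows "eval_at (y :: 'v \<Rightarrow> real) (rayleigh_diff P e g) \<ge> 0"
proof -
  define p where "p i j k = eval_at (y(e := i, f := j, g := k)) P" for i j k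
  have p': "eval_at (y(e := i, g := k, f := j)) P = p i j k" for i j k
    using d by (simp add: p_def fun_upd_twist)
  note q1 = rayleigh_diff_quadratic[OF P d, of y, folded p_def]
  note q2 = rayleigh_diff_quadratic[OF P d(2,1) d(3)[symmetric], of y, unfolded p']
  \<comment> \<open>The trivial update exhibits the value as that of the quadratic in coordinate
    \<open>f\<close>.\<close>
  have "eval_at (y(f := y f)) (rayleigh_diff P e g) \<ge> 0"
    unfolding q2(3)
  proof (rule quadratic_nonneg_if_discriminant)
    have "(p 1 0 0 * (p 0 1 1 - p 0 1 0) + p 0 1 0 * (p 1 0 1 - p 1 0 0)
        - p 1 1 0 * (p 0 0 1 - p 0 0 0) - p 0 0 0 * (p 1 1 1 - p 1 1 0))\<^sup>2 \<le>
      4 * eval_at y (rayleigh_diff (contraction g P) e f) *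
        eval_at y (rayleigh_diff (deletion g P) e f)"
      using ef[of "y(g := t)" for t] unfolding q1(3) by (rule quadratic_nonneg_imp_discriminant)
    then show "(p 1 0 0 * (p 0 1 1 - p 0 0 1) + p 0 0 1 * (p 1 1 0 - p 1 0 0)
        - p 1 0 1 * (p 0 1 0 - p 0 0 0) - p 0 0 0 * (p 1 1 1 - p 1 0 1))\<^sup>2 \<le>
      4 * eval_at y (rayleigh_diff (contraction f P) e g) *
        eval_at y (rayleigh_diff (deletion f P) e g)"
      unfolding q1(1,2) q2(1,2)
      using hyperdeterminant_symmetric[of "p 1 0 0" "p 0 1 1" "p 0 1 0" "p 1 0 1" "p 1 1 0"
          "p 0 0 1" "p 0 0 0" "p 1 1 1"] by linarith
  qed (rule con del)+
  then show ?thesis by simp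
qed

lemma rayleigh_diff_commute:
  fixes P :: "'v rpoly" and y :: "'v \<Rightarrow> real"
  assumes "multiaffine P" "e \<noteq> f"
  shows "eval_at y (rayleigh_diff P f e) = eval_at y (rayleigh_diff P e f)"
  using assms by (simp add: eval_at_rayleigh_diff fun_upd_twist mult.commute)

text \<open>One exchange leads from \<open>{e, f}\<close> to any pair containing \<open>e\<close>;
  after swapping the roles of its two indices, a second exchange leads to any pair.\<close>

lemma strong_rayleigh_if_pair:
  fixes P :: "'v rpoly"
  assumes P: "multiaffine P" and ef: "e \<in> E" "f \<in> E" "e \<noteq> f"
    and minors: "\<And>g. g \<in> E \<Longrightarrow> strong_rayleigh (E - {g}) (contraction g P)"
      "\<And>g. g \<in> E \<Longrightarrow> strong_rayleigh (E - {g}) (deletion g P)"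
    and nonneg: "\<And>y :: 'v \<Rightarrow> real. eval_at y (rayleigh_diff P e f) \<ge> 0"
  shows "strong_rayleigh E P"
proof -
  define R where "R a b \<longleftrightarrow> (\<forall>y :: 'v \<Rightarrow> real. eval_at y (rayleigh_diff P a b) \<ge> 0)" for a b
  have exchange: "R a c" if "R a b" "a \<in> E" "b \<in> E" "c \<in> E" "a \<noteq> b" "a \<noteq> c" for a b c
  proof (cases "b = c")
    case False
    with that minors[of b] show ?thesis
      unfolding R_def
      by (intro allI rayleigh_diff_nonneg_exchange[OF P, of a b c]) (auto simp: strong_rayleigh_def)
  qed (use that in simp)
  have sym: "R b a" if "R a b" "a \<noteq> b" for a b
    using that P by (simp add: R_def rayleigh_diff_commute)
  have e: "R e h" if "h \<in> E" "h \<noteq> e" for h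
    using exchange[of e f h] nonneg that ef by (auto simp: R_def)
  have "R g h" if "g \<in> E" "h \<in> E" "g \<noteq> h" for g h
  proof (cases "g = e")
    case False
    then show ?thesis
      using exchange[of g e h] sym[OF e[of g]] that ef by auto
  qed (use e that in auto)
  then show ?thesis
    by (simp add: R_def strong_rayleigh_def)
qed

section \<open>Inheritance of the strong Rayleigh property\<close>

text \<open>Fixing \<open>y e\<close> commutes with forming the Rayleigh difference of two other
  indices.\<close>

lemma strong_rayleigh_restrict_var:
  assumes P: "multiaffine P" and "strong_rayleigh E P"
  shows "strong_rayleigh (E - {e}) (restrict_var e x P)"
  unfolding strong_rayleigh_def
proof (intro allI ballI impI)
  fix y :: "'a \<Rightarrow> real" and f g
  assume fg: "f \<in> E - {e}" "g \<in> E - {e}" "f \<noteq> g"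
  have "y(f := i, g := j, e := x) = y(e := x, f := i, g := j)" for i j
    using fg by auto
  then have "eval_at y (rayleigh_diff (restrict_var e x P) f g) =
      eval_at (y(e := x)) (rayleigh_diff P f g)"
    using fg
    by (simp add: eval_at_rayleigh_diff multiaffine_restrict_var eval_at_restrict_var P
        del: fun_upd_apply)
  with fg assms(2) show "eval_at y (rayleigh_diff (restrict_var e x P) f g) \<ge> 0"
    by (simp add: strong_rayleigh_def)
qed

lemma restrict_var_0: "restrict_var e 0 P = deletion e P"
  by (simp add: restrict_var_def)

lemma strong_rayleigh_deletion:
  "multiaffine P \<Longrightarrow> strong_rayleigh E P \<Longrightarrow> strong_rayleigh (E - {e}) (deletion e P)"
  using strong_rayleigh_restrict_var[of P E e 0] by (simp add: restrict_var_0)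

text \<open>The Rayleigh difference of the contraction is the leading coefficient of a quadratic in
  \<open>y e\<close> that is nonnegative on the real line.\<close>

lemma strong_rayleigh_contraction:
  assumes P: "multiaffine P" and "strong_rayleigh E P"
  shows "strong_rayleigh (E - {e}) (contraction e P)"
  unfolding strong_rayleigh_def
proof (intro allI ballI impI)
  fix y :: "'a \<Rightarrow> real" and f g
  assume fg: "f \<in> E - {e}" "g \<in> E - {e}" "f \<noteq> g"
  then have d: "f \<noteq> g" "f \<noteq> e" "g \<noteq> e" by auto
  have "eval_at (y(e := t)) (rayleigh_diff P f g) \<ge> 0" for t
    using fg assms(2) by (simp add: strong_rayleigh_def)
  then show "eval_at y (rayleigh_diff (contraction e P) f g) \<ge> 0"
    unfolding rayleigh_diff_quadratic(3)[OF P d] by (rule quadratic_nonneg_leading)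
qed

section \<open>The strong Rayleigh property implies stability\<close>

text \<open>An affine function with two distinct zeros vanishes, so the coordinates can be released
  from the grid one at a time. The grid is real while \<open>y\<close> may be complex, which carries
  identities from real to complex points.\<close>

lemma eval_at_zero_if_zero_on_grid:
  fixes Q :: "'v rpoly" and p q :: "'v \<Rightarrow> real" and y :: "'v \<Rightarrow> 'a::real_field"
  assumes Q: "multiaffine Q" and vars: "vars Q \<subseteq> E" and "finite E"
    and pq: "\<And>c. p c \<noteq> q c"
    and grid: "\<And>S. S \<subseteq> E \<Longrightarrow> eval_at (\<lambda>c. if c \<in> S then q c else p c) Q = 0"
  shows "eval_at y Q = 0"
proof -
  \<comment> \<open>\<open>F\<close> holds the released coordinates; \<open>S\<close> records which
    grid value each remaining one takes.\<close>
  have "eval_at y Q = 0"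
    if "finite F" "\<And>c. c \<in> E - F \<Longrightarrow> y c = of_real (if c \<in> S then q c else p c)"
    for F S and y :: "'v \<Rightarrow> 'a"
    using that
  proof (induction F arbitrary: S y)
    case empty
    have "eval_at y Q = eval_at (\<lambda>c. of_real (if c \<in> S \<inter> E then q c else p c)) Q"
      using vars empty by (intro eval_at_cong) (auto simp: subset_iff)
    also have "\<dots> = of_real (eval_at (\<lambda>c. if c \<in> S \<inter> E then q c else p c) Q)"
      by (rule eval_at_of_real)
    finally show ?case
      using grid[of "S \<inter> E"] by simp
  next
    case (insert e F)
    define g0 g1 where "g0 = eval_at (y(e := 0)) Q" and "g1 = eval_at (y(e := 1)) Q"
    have g: "eval_at (y(e := t)) Q = (1 - t) * g0 + t * g1" for t
      unfolding g0_def g1_def by (rule eval_at_upd_affine[OF Q])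
    have "eval_at (y(e := of_real (p e))) Q = 0"
      by (rule insert.IH[of _ "S - {e}"]) (use insert.prems in auto)
    moreover have "eval_at (y(e := of_real (q e))) Q = 0"
      by (rule insert.IH[of _ "insert e S"]) (use insert.prems in auto)
    ultimately have p0: "g0 + of_real (p e) * (g1 - g0) = 0"
        and q0: "g0 + of_real (q e) * (g1 - g0) = 0"
      unfolding g by (simp_all add: algebra_simps)
    have "of_real (p e - q e) * (g1 - g0) =
        (g0 + of_real (p e) * (g1 - g0)) - (g0 + of_real (q e) * (g1 - g0))"
      by (simp add: algebra_simps)
    also have "\<dots> = 0"
      unfolding p0 q0 by simp
    finally have "g1 - g0 = 0"
      using pq[of e] by (simp del: of_real_diff)
    with p0 have "g0 = 0" "g1 = 0"
      by auto
    with g[of "y e"] show ?case by simp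
  qed
  from this[OF \<open>finite E\<close>, of y "{}"] show ?thesis by simp
qed

text \<open>The Rayleigh difference is the Wronskian in \<open>y f\<close> of \<open>P^e\<close> and
  \<open>P_e\<close>, so where it vanishes their ratio does not change along \<open>y f\<close>.
  Cross-multiplication avoids dividing by a possibly zero \<open>P_e\<close>.\<close>

lemma eval_at_proportional_if_rayleigh_diff_zero:
  fixes P :: "'v rpoly" and z :: "'v \<Rightarrow> real"
  assumes P: "multiaffine P" and ef: "e \<noteq> f" and zero: "eval_at z (rayleigh_diff P e f) = 0"
    and z': "z' = z(f := t)"
  shows "eval_at z (deletion e P) * eval_at z' (contraction e P) =
    eval_at z' (deletion e P) * eval_at z (contraction e P)"
proof -
  define p where "p i j = eval_at (z(e := i, f := j)) P" for i j
  have eq: "p 1 0 * p 0 1 = p 1 1 * p 0 0"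
    using zero by (simp add: eval_at_rayleigh_diff[OF P ef] p_def)
  have z_eval: "eval_at (z(e := i)) P = (1 - z f) * p i 0 + z f * p i 1" for i
    using eval_at_affine[OF P, of "z(e := i)" f] ef by (simp add: p_def)
  have z'_eval: "eval_at (z'(e := i)) P = (1 - t) * p i 0 + t * p i 1" for i
    using eval_at_upd_affine[OF P, of "z(e := i)" f t] ef
    by (simp add: p_def z' fun_upd_twist[of f e])
  show ?thesis
    unfolding eval_at_deletion[OF P] eval_at_contraction[OF P] z_eval z'_eval
    using eq by algebra
qed

text \<open>Moving one coordinate at a time, the ratio \<open>P^e / P_e\<close> stays constant; the
  obtained \<open>r\<close> is minus this constant.\<close>

lemma exists_affine_dependence:
  fixes P :: "'v rpoly" and w :: "'v \<Rightarrow> complex"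
  assumes P: "multiaffine P" and vars: "vars P \<subseteq> insert e E" and E: "finite E" "e \<notin> E"
    and zero: "\<And>f (x :: 'v \<Rightarrow> real). f \<in> E \<Longrightarrow> eval_at x (rayleigh_diff P e f) = 0"
    and nz: "eval_at w (contraction e P) \<noteq> 0"
  obtains r where "\<And>y :: 'v \<Rightarrow> complex. eval_at y (restrict_var e r P) = 0"
proof -
  let ?A = "deletion e P" and ?B = "contraction e P"
  have B: "multiaffine ?B" "vars ?B \<subseteq> E"
    using multiaffine_contraction[OF P] vars_contraction[OF P, of e] vars by auto
  have "\<exists>x :: 'v \<Rightarrow> real. eval_at x ?B \<noteq> 0"
  proof (rule ccontr)
    assume "\<not> ?thesis"
    then have zero_B: "eval_at x ?B = 0" for x :: "'v \<Rightarrow> real"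
      by blast
    have "eval_at w ?B = 0"
      by (rule eval_at_zero_if_zero_on_grid[OF B E(1), of "\<lambda>_. 0" "\<lambda>_. 1"])
        (simp_all add: zero_B)
    with nz show False by simp
  qed
  then obtain x :: "'v \<Rightarrow> real" where x: "eval_at x ?B \<noteq> 0" ..
  \<comment> \<open>Vertices of a small cube at \<open>x\<close>. By continuity \<open>P_e\<close>
    is nonzero at all of these finitely many points once \<epsilon> is small, so the ratio passes
    from vertex to vertex.\<close>
  define X where "X \<epsilon> S = (\<lambda>c. if c \<in> S then x c + \<epsilon> else x c)" for \<epsilon> :: real and S
  have "eventually (\<lambda>\<epsilon>. eval_at (X \<epsilon> S) ?B \<noteq> 0) (at_right 0)" for S
  proof -
    have "isCont (\<lambda>\<epsilon>. X \<epsilon> S c) 0" for c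
      by (cases "c \<in> S") (auto simp: X_def)
    then have "isCont (\<lambda>\<epsilon>. eval_at (X \<epsilon> S) ?B) 0"
      by (rule continuous_eval_at)
    then have "((\<lambda>\<epsilon>. eval_at (X \<epsilon> S) ?B) \<longlongrightarrow> eval_at (X 0 S) ?B) (at_right 0)"
      by (auto simp: isCont_def intro: tendsto_within_subset)
    moreover have "X 0 S = x"
      by (auto simp: X_def)
    ultimately show ?thesis
      using x by (auto intro: tendsto_imp_eventually_ne)
  qed
  then have "eventually (\<lambda>\<epsilon>. \<forall>S\<in>Pow E. eval_at (X \<epsilon> S) ?B \<noteq> 0) (at_right 0)"
    using E(1) by (intro eventually_ball_finite) auto
  then have "eventually (\<lambda>\<epsilon>. (\<forall>S\<in>Pow E. eval_at (X \<epsilon> S) ?B \<noteq> 0) \<and> \<epsilon> > 0) (at_right 0)"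
    using eventually_at_right_less[of 0] by eventually_elim auto
  from eventually_happens'[OF trivial_limit_at_right_real this]
  obtain \<epsilon> where \<epsilon>: "\<And>S. S \<subseteq> E \<Longrightarrow> eval_at (X \<epsilon> S) ?B \<noteq> 0" "\<epsilon> > 0"
    by blast
  define r where "r = eval_at x ?A / eval_at x ?B"
  have r: "eval_at (X \<epsilon> S) ?A = r * eval_at (X \<epsilon> S) ?B" if "S \<subseteq> E" for S
    using finite_subset[OF that E(1)] that
  proof (induction S rule: finite_induct)
    case empty
    have "X \<epsilon> {} = x" by (simp add: X_def)
    with x show ?case by (simp add: r_def)
  next
    case (insert f S)
    have "X \<epsilon> (insert f S) = (X \<epsilon> S)(f := x f + \<epsilon>)"
      by (auto simp: X_def)
    from eval_at_proportional_if_rayleigh_diff_zero[OF P _ zero this] insert E(2)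
    have "eval_at (X \<epsilon> S) ?A * eval_at (X \<epsilon> (insert f S)) ?B =
      eval_at (X \<epsilon> (insert f S)) ?A * eval_at (X \<epsilon> S) ?B"
      by auto
    moreover have "eval_at (X \<epsilon> S) ?A = r * eval_at (X \<epsilon> S) ?B" "eval_at (X \<epsilon> S) ?B \<noteq> 0"
      using insert \<epsilon>(1) by auto
    ultimately show ?case by simp
  qed
  \<comment> \<open>The cube vertices serve as the grid on which \<open>P^e - r * P_e\<close>
    vanishes.\<close>
  have "eval_at y (restrict_var e (- r) P) = 0" for y :: "'v \<Rightarrow> complex"
  proof (rule eval_at_zero_if_zero_on_grid[OF multiaffine_restrict_var[OF P] _ E(1)])
    show "vars (restrict_var e (- r) P) \<subseteq> E"
      using vars_restrict_var[OF P, of e "- r"] vars by auto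
    show "x c \<noteq> x c + \<epsilon>" for c
      using \<epsilon>(2) by simp
    show "eval_at (\<lambda>c. if c \<in> S then x c + \<epsilon> else x c) (restrict_var e (- r) P) = 0"
      if "S \<subseteq> E" for S
      using r[OF that]
      by (simp add: X_def restrict_var_def eval_at_add eval_at_mult eval_at_single)
  qed
  then show thesis by (rule that)
qed

text \<open>Substituting a negative real can destroy positivity of the coefficients, or even give
  the zero polynomial. The induction therefore allows arbitrary real coefficients and keeps the null
  alternative.\<close>

lemma strong_rayleigh_imp_stable_or_null:
  fixes P :: "'v rpoly"
  assumes "finite E" "multiaffine P" "vars P \<subseteq> E" "strong_rayleigh E P"
  shows "stable_on E P \<or> (\<forall>y :: 'v \<Rightarrow> complex. eval_at y P = 0)"
  using assms
proof (induction E arbitrary: P rule: finite_induct)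
  case empty
  then have "eval_at y P = eval_at z P" for y z :: "'v \<Rightarrow> complex"
    by (intro eval_at_cong) auto
  then show ?case
    by (metis stable_on_def)
next
  case (insert e E)
  note P = \<open>multiaffine P\<close>
  define A B where "A y = eval_at y (deletion e P)" and "B y = eval_at y (contraction e P)"
    for y :: "'v \<Rightarrow> complex"
  have P_eq: "eval_at y P = A y + y e * B y" for y
    using eval_at_affine[OF P, of y e]
    by (simp add: A_def B_def eval_at_deletion[OF P] eval_at_contraction[OF P] algebra_simps)
  have restrict_eq: "eval_at y (restrict_var e x P) = A y + of_real x * B y" for x y
    by (simp add: A_def B_def restrict_var_def eval_at_add eval_at_mult eval_at_single)
  \<comment> \<open>Only coordinates in \<open>E\<close> are constrained; \<open>y e\<close> stays
    free and will later be taken in the lower half-plane.\<close>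
  define H where "H = {y :: 'v \<Rightarrow> complex. \<forall>c\<in>E. Im (y c) > 0}"
  have Ediff: "insert e E - {e} = E"
    using insert.hyps by auto
  have restrict: "stable_on E (restrict_var e x P) \<or>
      (\<forall>y :: 'v \<Rightarrow> complex. eval_at y (restrict_var e x P) = 0)" for x
    using insert.prems strong_rayleigh_restrict_var[of P "insert e E" e x]
      vars_restrict_var[OF P, of e x]
    by (intro insert.IH multiaffine_restrict_var) (auto simp: Ediff)
  have contr: "stable_on E (contraction e P) \<or>
      (\<forall>y :: 'v \<Rightarrow> complex. eval_at y (contraction e P) = 0)"
    using insert.prems strong_rayleigh_contraction[of P "insert e E" e]
      vars_contraction[OF P, of e]
    by (intro insert.IH multiaffine_contraction) (auto simp: Ediff)
  show ?case
  proof (cases "\<forall>y. B y = 0")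
    case True
    then show ?thesis
      using restrict[of 0] by (auto simp: P_eq restrict_eq stable_on_def)
  next
    case False
    then obtain w where w: "B w \<noteq> 0" by auto
    with contr have B: "B y \<noteq> 0" if "y \<in> H" for y
      using that by (auto simp: B_def stable_on_def H_def)
    have ratio: "A y / B y = - y e" if "y \<in> H" "eval_at y P = 0" for y
    proof -
      have "A y = - y e * B y"
        using that(2) by (simp add: P_eq add_eq_0_iff2)
      then show ?thesis
        using B[OF that(1)] by simp
    qed
    show ?thesis
    proof (cases "\<exists>x. \<forall>y :: 'v \<Rightarrow> complex. eval_at y (restrict_var e x P) = 0")
      case True
      \<comment> \<open>Here \<open>A = - x * B\<close>, so \<open>P\<close> factors as
        \<open>(y e - x) * B\<close>, and neither factor vanishes on the upper half-planes.\<close>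
      then obtain x where "A y + of_real x * B y = 0" for y
        by (auto simp: restrict_eq)
      then have "A y = - (of_real x * B y)" for y
        by (simp add: add_eq_0_iff2)
      then have "eval_at y P = (y e - of_real x) * B y" for y
        by (simp add: P_eq algebra_simps)
      moreover have "y e \<noteq> of_real x" if "Im (y e) > 0" for y :: "'v \<Rightarrow> complex"
        using that by auto
      ultimately have "stable_on (insert e E) P"
        using B by (simp add: stable_on_def H_def)
      then show ?thesis ..
    next
      case False
      \<comment> \<open>A real value of \<open>A / B\<close> would give a zero of the restriction at
        minus that value, which is stable because it is not null.\<close>
      have Im_nz: "Im (A y / B y) \<noteq> 0" if "y \<in> H" for y
      proof
        assume "Im (A y / B y) = 0"
        then have "A y / B y = of_real (Re (A y / B y))"
          by (simp add: complex_eq_iff)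
        then have "A y = of_real (Re (A y / B y)) * B y"
          using B[OF that] by (metis nonzero_eq_divide_eq)
        then have "A y + of_real (- Re (A y / B y)) * B y = 0"
          by (simp only: of_real_minus) algebra
        then show False
          using restrict[of "- Re (A y / B y)"] False that
          unfolding stable_on_def H_def restrict_eq by blast
      qed
      show ?thesis
      proof (cases "\<forall>y\<in>H. Im (A y / B y) > 0")
        case True
        have "eval_at y P \<noteq> 0" if "\<forall>c\<in>insert e E. Im (y c) > 0" for y
        proof
          assume "eval_at y P = 0"
          moreover have "y \<in> H" using that by (simp add: H_def)
          ultimately have "Im (- y e) > 0"
            using True ratio[of y] by metis
          then show False
            using that by simp
        qed
        then show ?thesis by (auto simp: stable_on_def)
      next
        case not_pos: False
        then obtain y0 where y0: "y0 \<in> H" "Im (A y0 / B y0) < 0"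
          using Im_nz by (auto simp: not_less order_le_less)
        have Im_neg: "Im (A y / B y) < 0" if y: "y \<in> H" for y
        proof (rule ccontr)
          assume "\<not> Im (A y / B y) < 0"
          \<comment> \<open>\<open>H\<close> is convex, so a sign change would yield a zero of the
            imaginary part on the segment from \<open>y0\<close> to \<open>y\<close>.\<close>
          define \<gamma> where "\<gamma> t = (\<lambda>c. y0 c + of_real t * (y c - y0 c))" for t
          have \<gamma>_H: "\<gamma> t \<in> H" if "0 \<le> t" "t \<le> 1" for t
          proof -
            have "Im (\<gamma> t c) > 0" if "c \<in> E" for c
            proof -
              have "Im (\<gamma> t c) = (1 - t) * Im (y0 c) + t * Im (y c)"
                by (simp add: \<gamma>_def algebra_simps)
              also have "\<dots> > 0"
                using y y0(1) that \<open>0 \<le> t\<close> \<open>t \<le> 1\<close>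
                by (cases "t = 0") (auto simp: H_def intro!: add_nonneg_pos)
              finally show ?thesis .
            qed
            then show ?thesis by (simp add: H_def)
          qed
          have ends: "\<gamma> 0 = y0" "\<gamma> 1 = y"
            by (auto simp: \<gamma>_def)
          have "isCont (\<lambda>t. A (\<gamma> t)) t" "isCont (\<lambda>t. B (\<gamma> t)) t" for t
            unfolding A_def B_def \<gamma>_def
            by (intro continuous_eval_at continuous_intros)+
          then have "isCont (\<lambda>t. Im (A (\<gamma> t) / B (\<gamma> t))) t" if "0 \<le> t" "t \<le> 1" for t
            using B[OF \<gamma>_H[OF that]] by (intro isCont_Im continuous_intros)
          then obtain t where "0 \<le> t" "t \<le> 1" "Im (A (\<gamma> t) / B (\<gamma> t)) = 0"
            using IVT[of "\<lambda>t. Im (A (\<gamma> t) / B (\<gamma> t))" 0 0 1] y0(2) \<open>\<not> Im (A y / B y) < 0\<close>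
            by (auto simp: ends)
          with Im_nz[OF \<gamma>_H] show False by blast
        qed
        have zero: "eval_at x (rayleigh_diff P e f) = 0" if f: "f \<in> E" for f and x :: "'v \<Rightarrow> real"
        proof (rule antisym)
          have ef: "e \<noteq> f" using f insert.hyps by auto
          then show "0 \<le> eval_at x (rayleigh_diff P e f)"
            using insert.prems f by (auto simp: strong_rayleigh_def)
          show "eval_at x (rayleigh_diff P e f) \<le> 0"
          proof (rule ccontr)
            assume "\<not> ?thesis"
            \<comment> \<open>With \<open>s = -1\<close> the zero has \<open>y e\<close> equal to
              minus the imaginary unit, so \<open>A / B\<close> has imaginary part 1, against
              \<open>Im_neg\<close>.\<close>
            then have "- 1 * eval_at x (rayleigh_diff P e f) < 0" by simp
            from zero_of_rayleigh_diff[OF P ef this] obtain y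
              where y: "y e = Complex 0 (- 1)" "\<And>c. c \<noteq> e \<Longrightarrow> Im (y c) > 0" "eval_at y P = 0"
              by metis
            have "y \<in> H"
              using y(2) insert.hyps by (force simp: H_def)
            from ratio[OF this y(3)]
            have "A y / B y = - y e" .
            with Im_neg[OF \<open>y \<in> H\<close>] y(1) show False by simp
          qed
        qed
        from exists_affine_dependence[OF P insert.prems(2) insert.hyps zero w[unfolded B_def]]
        obtain r where "\<And>y :: 'v \<Rightarrow> complex. eval_at y (restrict_var e r P) = 0"
          by metis
        with False show ?thesis by blast
      qed
    qed
  qed
qed

section \<open>The equivalences for positive coefficients\<close>

lemma positive_coeffs_eval_at_one:
  assumes "positive_coeffs P"
  shows "eval_at (\<lambda>_. 1 :: real) P > 0"
proof -
  have "Poly_Mapping.keys P \<noteq> {}"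
    using assms by (simp add: positive_coeffs_def)
  moreover have "Poly_Mapping.lookup P u > 0" if "u \<in> Poly_Mapping.keys P" for u
    using assms that by (auto simp: positive_coeffs_def in_keys_iff)
  ultimately show ?thesis
    by (auto simp: eval_at_def intro!: sum_pos)
qed

theorem theorem3:
  fixes m :: nat and E :: "nat set" and Z :: "nat rpoly"
  defines "E \<equiv> {1..m}"
  assumes "vars Z \<subseteq> E"
    and "multiaffine Z"
    and "positive_coeffs Z"
  shows "(stable_on E Z \<longleftrightarrow> strong_rayleigh E Z) \<and>
    (m \<ge> 2 \<longrightarrow>
      (strong_rayleigh E Z \<longleftrightarrow>
        (\<forall>e \<in> E. strong_rayleigh (E - {e}) (contraction e Z) \<and>
                  strong_rayleigh (E - {e}) (deletion e Z)) \<and>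
        (\<exists>e \<in> E. \<exists>f \<in> E. e \<noteq> f \<and>
          (\<forall>y :: nat \<Rightarrow> real. eval_at y (rayleigh_diff Z e f) \<ge> 0))))"
proof (intro conjI impI)
  note Z = \<open>multiaffine Z\<close>
  have "finite E" by (simp add: E_def)
  \<comment> \<open>Positivity of the coefficients excludes the null alternative.\<close>
  have "eval_at (\<lambda>_. of_real 1) Z \<noteq> (0 :: complex)"
    using positive_coeffs_eval_at_one[OF assms(4)] by (subst eval_at_of_real) simp
  then have "\<not> (\<forall>y :: nat \<Rightarrow> complex. eval_at y Z = 0)"
    by blast
  with strong_rayleigh_imp_stable_or_null[OF \<open>finite E\<close> Z assms(2)]
  show "stable_on E Z \<longleftrightarrow> strong_rayleigh E Z"
    using stable_imp_strong_rayleigh[OF Z] by blast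
  assume "m \<ge> 2"
  \<comment> \<open>These indices witness the pair in (c). With fewer than two indices (b) is
    vacuous, while no pair exists.\<close>
  then have "1 \<in> E" "2 \<in> E" by (auto simp: E_def)
  show "strong_rayleigh E Z \<longleftrightarrow>
        (\<forall>e \<in> E. strong_rayleigh (E - {e}) (contraction e Z) \<and>
                  strong_rayleigh (E - {e}) (deletion e Z)) \<and>
        (\<exists>e \<in> E. \<exists>f \<in> E. e \<noteq> f \<and>
          (\<forall>y :: nat \<Rightarrow> real. eval_at y (rayleigh_diff Z e f) \<ge> 0))"
    (is "_ \<longleftrightarrow> ?minors \<and> ?pair")
  proof (intro iffI conjI)
    assume SR: "strong_rayleigh E Z"
    then show ?minors
      using strong_rayleigh_contraction[OF Z] strong_rayleigh_deletion[OF Z] by blast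
    have "(1 :: nat) \<noteq> 2" by simp
    with SR \<open>1 \<in> E\<close> \<open>2 \<in> E\<close> show ?pair
      unfolding strong_rayleigh_def by blast
  next
    assume "?minors \<and> ?pair"
    then show "strong_rayleigh E Z"
      using strong_rayleigh_if_pair[OF Z] by blast
  qed
qed

end
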